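(* Let $W_n$ ($n\ge 3$) be the wheel graph. Then $\beta_M(W_3)=4$ and $\beta_M(W_n)=n$ for all $n\ge 4$.
   Context: The wheel $W_n$ has vertex set $\{v_0,v_1,\dots,v_n\}$ and edge set $\{v_0v_i : 1\le i\le n\}\cup\{v_iv_{i+1} : 1\le i\le n-1\}\cup\{v_nv_1\}$. For a connected graph $G=(V,E)$, $d(u,v)$ is the shortest-path distance between vertices, and for an edge $uv$ and vertex $w$, $d(uv,w)=\min\{d(u,w),d(v,w)\}$. A set $S\subseteq V$ is a mixed resolving set if for any two distinct elements $x,y\in V\cup E$ there is $w\in S$ with $d(x,w)\neq d(y,w)$. The mixed metric dimension $\beta_M(G)$ is the minimum cardinality of a mixed resolving set of $G$. *)

theory Defs
  imports Main
begin

text \<open>Undirected graphs: an edge is the set of its two endpoints.\<close>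

record 'a ugraph =
  verts :: "'a set"
  edges :: "'a set set"

definition simple_graph :: "'a ugraph \<Rightarrow> bool" where
  "simple_graph G \<longleftrightarrow> finite (verts G) \<and> (\<forall>e \<in> edges G. e \<subseteq> verts G \<and> card e = 2)"

text \<open>A path is given by its list of vertices, so its length is \<open>length p - 1\<close>.\<close>

definition is_path :: "'a ugraph \<Rightarrow> 'a \<Rightarrow> 'a list \<Rightarrow> 'a \<Rightarrow> bool" where
  "is_path G u p v \<longleftrightarrow>
     p \<noteq> [] \<and> hd p = u \<and> last p = v \<and> distinct p \<and> set p \<subseteq> verts G \<and>
     successively (\<lambda>a b. {a, b} \<in> edges G) p"

definition connected_graph :: "'a ugraph \<Rightarrow> bool" where
  "connected_graph G \<longleftrightarrow>
     verts G \<noteq> {} \<and> (\<forall>u \<in> verts G. \<forall>v \<in> verts G. \<exists>p. is_path G u p v)"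

text \<open>The distance is meaningful only when some path joins \<open>u\<close> and \<open>v\<close>,
  hence for all pairs of vertices of a connected graph.\<close>

definition vdist :: "'a ugraph \<Rightarrow> 'a \<Rightarrow> 'a \<Rightarrow> nat" where
  "vdist G u v = (LEAST k. \<exists>p. is_path G u p v \<and> k = length p - 1)"

text \<open>Elements of the disjoint union of \<open>verts G\<close> and \<open>edges G\<close>: vertices are tagged
  by \<open>Inl\<close>, edges by \<open>Inr\<close>.\<close>

fun elem_dist :: "'a ugraph \<Rightarrow> 'a + 'a set \<Rightarrow> 'a \<Rightarrow> nat" where
  "elem_dist G (Inl v) w = vdist G v w"
| "elem_dist G (Inr e) w = Min ((\<lambda>u. vdist G u w) ` e)"

definition mixed_resolving :: "'a ugraph \<Rightarrow> 'a set \<Rightarrow> bool" where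
  "mixed_resolving G S \<longleftrightarrow>
     S \<subseteq> verts G \<and>
     (\<forall>x \<in> verts G <+> edges G. \<forall>y \<in> verts G <+> edges G.
        x \<noteq> y \<longrightarrow> (\<exists>w \<in> S. elem_dist G x w \<noteq> elem_dist G y w))"

text \<open>Meant for finite connected graphs, where the whole vertex set is mixed resolving,
  so that the minimum exists.\<close>

definition mixed_metric_dim :: "'a ugraph \<Rightarrow> nat" where
  "mixed_metric_dim G = (LEAST k. \<exists>S. mixed_resolving G S \<and> card S = k)"

text \<open>The hub is \<open>0\<close>, the rim is the cycle \<open>1, \<dots>, n\<close>.\<close>

definition wheel :: "nat \<Rightarrow> nat ugraph" where
  "wheel n = \<lparr> verts = {0..n},
     edges = {{0, i} | i. 1 \<le> i \<and> i \<le> n} \<union> {{i, i + 1} | i. 1 \<le> i \<and> i < n} \<union> {{n, 1}} \<rparr>"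

lemma simple_graph_wheel: "n \<ge> 3 \<Longrightarrow> simple_graph (wheel n)"
  unfolding simple_graph_def wheel_def by (auto simp: card_insert_if)

lemma connected_graph_wheel: "connected_graph (wheel n)"
proof -
  have "\<exists>p. is_path (wheel n) u p v" if "u \<le> n" "v \<le> n" for u v
  proof -
    consider "u = v" | "u \<noteq> v" "u = 0 \<or> v = 0" | "u \<noteq> v" "u \<noteq> 0" "v \<noteq> 0" by blast
    then show ?thesis
    proof cases
      case 1
      then have "is_path (wheel n) u [u] v"
        using that by (auto simp: is_path_def wheel_def)
      then show ?thesis ..
    next
      case 2
      then have "is_path (wheel n) u [u, v] v"
        using that by (auto simp: is_path_def wheel_def insert_commute)
      then show ?thesis ..
    next
      case 3
      then have "{u, 0} \<in> edges (wheel n)" "{0, v} \<in> edges (wheel n)"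
        using that by (auto simp: wheel_def insert_commute)
      then have "is_path (wheel n) u [u, 0, v] v"
        using 3 that by (auto simp: is_path_def wheel_def)
      then show ?thesis ..
    qed
  qed
  then show ?thesis by (auto simp: connected_graph_def wheel_def)
qed

end

theory Submission
  imports Defs
begin

text \<open>If \<open>v\<close> is adjacent to every other vertex, then only \<open>u\<close> itself separates the vertex \<open>v\<close>
  from the edge \<open>vu\<close>: a separating \<open>w\<close> satisfies \<open>d(u,w) < d(v,w) \<le> 1\<close>. Hence every mixed
  resolving set contains all vertices other than \<open>v\<close>, that is, the whole rim of \<open>W\<^sub>n\<close> and,
  as \<open>W\<^sub>3 = K\<^sub>4\<close>, all the vertices of \<open>W\<^sub>3\<close>. Conversely, the vertices at distance zero from an
  element are its endpoints, so the whole vertex set always resolves, and the rim separates all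
  elements except possibly a rim vertex \<open>i\<close> from its spoke; for \<open>n \<ge> 4\<close> these are separated by a
  rim vertex at distance two from \<open>i\<close>.\<close>

section \<open>Small distances in connected graphs\<close>

lemma vdist_le: "is_path G u p v \<Longrightarrow> vdist G u v \<le> length p - 1"
  unfolding vdist_def by (rule Least_le) blast

lemma vdist_path:
  assumes "connected_graph G" "u \<in> verts G" "v \<in> verts G"
  obtains p where "is_path G u p v" "length p = Suc (vdist G u v)"
proof -
  from assms obtain q where "is_path G u q v"
    unfolding connected_graph_def by blast
  then have "\<exists>k p. is_path G u p v \<and> k = length p - 1" by blast
  then have "\<exists>p. is_path G u p v \<and> vdist G u v = length p - 1"
    unfolding vdist_def by (rule LeastI_ex)
  then obtain p where p: "is_path G u p v" "vdist G u v = length p - 1" by blast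
  \<comment> \<open>Paths are nonempty, so the truncated subtraction in \<open>length p - 1\<close>
    loses nothing.\<close>
  then have "length p = Suc (vdist G u v)" by (cases p) (auto simp: is_path_def)
  with p that show thesis by blast
qed

lemma vdist_eq_0_iff:
  assumes "connected_graph G" "u \<in> verts G" "v \<in> verts G"
  shows "vdist G u v = 0 \<longleftrightarrow> u = v"
proof
  assume "vdist G u v = 0"
  with vdist_path[OF assms] obtain p where "is_path G u p v" "length p = Suc 0" by metis
  then show "u = v" by (auto simp: is_path_def length_Suc_conv)
next
  assume "u = v"
  then have "is_path G u [u] v" using assms by (simp add: is_path_def)
  from vdist_le[OF this] show "vdist G u v = 0" by simp
qed

lemma vdist_le_1_iff:
  assumes "connected_graph G" "u \<in> verts G" "v \<in> verts G"
  shows "vdist G u v \<le> 1 \<longleftrightarrow> u = v \<or> {u, v} \<in> edges G"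
proof
  assume le: "vdist G u v \<le> 1"
  show "u = v \<or> {u, v} \<in> edges G"
  proof (cases "vdist G u v = 0")
    case True
    then show ?thesis using vdist_eq_0_iff[OF assms] by simp
  next
    case False
    with le vdist_path[OF assms] obtain p
      where "is_path G u p v" "length p = Suc (Suc 0)" by (metis One_nat_def le_eq_less_or_eq less_one)
    then show ?thesis by (auto simp: is_path_def length_Suc_conv)
  qed
next
  assume R: "u = v \<or> {u, v} \<in> edges G"
  show "vdist G u v \<le> 1"
  proof (cases "u = v")
    case True
    then show ?thesis using vdist_eq_0_iff[OF assms] by simp
  next
    case False
    with R have "is_path G u [u, v] v" using assms by (simp add: is_path_def)
    from vdist_le[OF this] show ?thesis by simp
  qed
qed

section \<open>Endpoints and mixed resolving sets in general graphs\<close>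

fun ends :: "'a + 'a set \<Rightarrow> 'a set" where
  "ends (Inl v) = {v}"
| "ends (Inr e) = e"

text \<open>Since every edge has two distinct endpoints, no edge shares its endpoint set with a
  vertex.\<close>

lemma ends_inject:
  assumes "simple_graph G" "x \<in> verts G <+> edges G" "y \<in> verts G <+> edges G"
    and "ends x = ends y"
  shows "x = y"
  using assms unfolding simple_graph_def by (cases x; cases y) fastforce+

lemma elem_dist_eq_0_iff:
  assumes "simple_graph G" "connected_graph G" "x \<in> verts G <+> edges G" "w \<in> verts G"
  shows "elem_dist G x w = 0 \<longleftrightarrow> w \<in> ends x"
proof (cases x)
  case (Inl v)
  then show ?thesis using assms vdist_eq_0_iff[of G v w] by auto
next
  case (Inr e)
  then have e: "e \<subseteq> verts G" "card e = 2" using assms by (auto simp: simple_graph_def)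
  then have "finite e" "e \<noteq> {}" by (auto intro: card_ge_0_finite)
  then have "Min ((\<lambda>u. vdist G u w) ` e) = 0 \<longleftrightarrow> (\<exists>u\<in>e. vdist G u w = 0)"
    using Min_in[of "(\<lambda>u. vdist G u w) ` e"] Min_le[of "(\<lambda>u. vdist G u w) ` e" 0]
    by (fastforce simp: image_iff)
  also have "\<dots> \<longleftrightarrow> w \<in> e" using e assms vdist_eq_0_iff[of G _ w] by blast
  finally show ?thesis using Inr by simp
qed

text \<open>A member of \<open>S\<close> lying on exactly one of the two elements is at distance
  zero from that one only.\<close>

lemma elem_dist_neq_if_ends:
  assumes "simple_graph G" "connected_graph G"
    and "x \<in> verts G <+> edges G" "y \<in> verts G <+> edges G" "S \<subseteq> verts G"
    and "ends x \<inter> S \<noteq> ends y \<inter> S"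
  shows "\<exists>w \<in> S. elem_dist G x w \<noteq> elem_dist G y w"
proof -
  from assms(6) obtain w where w: "w \<in> S" "w \<in> ends x \<longleftrightarrow> w \<notin> ends y" by blast
  then have "w \<in> verts G" using assms by blast
  with w show ?thesis using elem_dist_eq_0_iff[OF assms(1,2)] assms(3,4) by metis
qed

lemma mixed_resolving_verts:
  assumes "simple_graph G" "connected_graph G"
  shows "mixed_resolving G (verts G)"
proof -
  have sub: "ends x \<subseteq> verts G" if "x \<in> verts G <+> edges G" for x
    using that assms by (auto simp: simple_graph_def)
  have "\<exists>w \<in> verts G. elem_dist G x w \<noteq> elem_dist G y w"
    if "x \<in> verts G <+> edges G" "y \<in> verts G <+> edges G" "x \<noteq> y" for x y
    using elem_dist_neq_if_ends[OF assms that(1,2) order_refl] sub[OF that(1)] sub[OF that(2)]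
      ends_inject[OF assms(1) that(1,2)] that(3) by (metis Int_absorb2)
  then show ?thesis unfolding mixed_resolving_def by blast
qed

lemma mixed_resolving_dominating_vertex:
  assumes "connected_graph G" "mixed_resolving G S" "v \<in> verts G"
    and dom: "\<And>w. w \<in> verts G \<Longrightarrow> w \<noteq> v \<Longrightarrow> {v, w} \<in> edges G"
  shows "verts G - {v} \<subseteq> S"
proof
  fix u assume u: "u \<in> verts G - {v}"
  with dom have "{v, u} \<in> edges G" by blast
  then have "Inl v \<in> verts G <+> edges G" "Inr {v, u} \<in> verts G <+> edges G"
    using assms(3) by blast+
  then obtain w where w: "w \<in> S" "elem_dist G (Inl v) w \<noteq> elem_dist G (Inr {v, u}) w"
    using assms(2) unfolding mixed_resolving_def by (metis Inl_Inr_False)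
  then have wG: "w \<in> verts G" using assms(2) unfolding mixed_resolving_def by blast
  then have "vdist G v w \<le> 1"
    using dom[of w] vdist_le_1_iff[OF assms(1,3)] by auto
  \<comment> \<open>The distance from the edge is the minimum over \<open>v\<close> and
    \<open>u\<close>, so it can differ from that of \<open>v\<close> only if \<open>u\<close> is
    strictly closer.\<close>
  moreover have "vdist G u w < vdist G v w" using w(2) by (auto simp: min_def split: if_splits)
  ultimately have "vdist G u w = 0" by simp
  then have "u = w" using vdist_eq_0_iff[OF assms(1) _ wG] u by blast
  with w show "u \<in> S" by simp
qed

lemma mixed_metric_dim_eqI:
  assumes "mixed_resolving G B" "finite (verts G)"
    and "\<And>S. mixed_resolving G S \<Longrightarrow> B \<subseteq> S"
  shows "mixed_metric_dim G = card B"
  unfolding mixed_metric_dim_def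
proof (rule Least_equality)
  show "\<exists>S. mixed_resolving G S \<and> card S = card B" using assms(1) by blast
next
  fix k assume "\<exists>S. mixed_resolving G S \<and> card S = k"
  then obtain S where S: "mixed_resolving G S" "card S = k" by blast
  \<comment> \<open>An infinite set would have \<open>card\<close> 0 by convention, so monotonicity
    of \<open>card\<close> needs this.\<close>
  then have "finite S" using assms(2) finite_subset unfolding mixed_resolving_def by blast
  with S assms(3) show "card B \<le> k" using card_mono by blast
qed

section \<open>Wheels: forced vertices and sufficiency of the rim\<close>

lemma verts_wheel: "verts (wheel n) = {0..n}"
  by (simp add: wheel_def)

lemma spoke_in_edges: "1 \<le> i \<Longrightarrow> i \<le> n \<Longrightarrow> {0, i} \<in> edges (wheel n)"
  by (auto simp: wheel_def)

lemma rim_subset_mixed_resolving: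
  assumes "mixed_resolving (wheel n) S"
  shows "{1..n} \<subseteq> S"
proof -
  have "verts (wheel n) - {0} \<subseteq> S"
    by (rule mixed_resolving_dominating_vertex[OF connected_graph_wheel assms])
       (auto simp: verts_wheel intro!: spoke_in_edges)
  then show ?thesis by (auto simp: verts_wheel subset_iff)
qed

text \<open>With only three rim vertices, the rim vertex 1 is dominating as well, and this forces
  the hub.\<close>

lemma hub_in_mixed_resolving_wheel_3:
  assumes "mixed_resolving (wheel 3) S"
  shows "0 \<in> S"
proof -
  have "{1, w} \<in> edges (wheel 3)" if "w \<in> verts (wheel 3)" "w \<noteq> 1" for w
  proof -
    from that consider "w = 0" | "w = 2" | "w = 3" by (force simp: verts_wheel)
    then show ?thesis
      by cases (auto simp: wheel_def doubleton_eq_iff)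
  qed
  then have "verts (wheel 3) - {1} \<subseteq> S"
    using mixed_resolving_dominating_vertex[OF connected_graph_wheel assms, of 1]
    by (auto simp: verts_wheel)
  then show ?thesis by (auto simp: verts_wheel)
qed

lemma exists_nonadjacent_rim_vertex:
  assumes "n \<ge> 4" "1 \<le> i" "i \<le> n"
  shows "\<exists>w \<in> {1..n}. w \<noteq> i \<and> {i, w} \<notin> edges (wheel n)"
proof -
  have nonadj: "{i, w} \<notin> edges (wheel n)"
    if "1 \<le> w" "w \<noteq> i + 1" "i \<noteq> w + 1" "\<not> (i = n \<and> w = 1)" "\<not> (i = 1 \<and> w = n)" for w
    using that assms(2) unfolding wheel_def by (auto simp: doubleton_eq_iff)
  \<comment> \<open>The first three cases go two steps forward along the rim (from \<open>n\<close>
    via 1 to 2), which misses the predecessor because n \<ge> 4. Otherwise 1 works, its rim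
    neighbours being 2 and \<open>n\<close>.\<close>
  consider "i = 1" | "i = 2" | "i = n" | "3 \<le> i" "i < n" using assms by linarith
  then show ?thesis
  proof cases
    case 1
    then show ?thesis using assms nonadj[of 3] by (intro bexI[of _ 3]) auto
  next
    case 2
    then show ?thesis using assms nonadj[of 4] by (intro bexI[of _ 4]) auto
  next
    case 3
    then show ?thesis using assms nonadj[of 2] by (intro bexI[of _ 2]) auto
  next
    case 4
    then show ?thesis using assms nonadj[of 1] by (intro bexI[of _ 1]) auto
  qed
qed

text \<open>The hub brings the spoke within distance 1 of every rim vertex, including those not
  adjacent to \<open>i\<close>.\<close>

lemma rim_separates_vertex_from_spoke:
  assumes "n \<ge> 4" "1 \<le> i" "i \<le> n"
  shows "\<exists>w \<in> {1..n}. elem_dist (wheel n) (Inl i) w \<noteq> elem_dist (wheel n) (Inr {0, i}) w"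
proof -
  from exists_nonadjacent_rim_vertex[OF assms]
  obtain w where w: "w \<in> {1..n}" "w \<noteq> i" "{i, w} \<notin> edges (wheel n)" by blast
  have "\<not> vdist (wheel n) i w \<le> 1"
    using vdist_le_1_iff[OF connected_graph_wheel, of i n w] w assms by (auto simp: verts_wheel)
  moreover have "vdist (wheel n) 0 w \<le> 1"
    using vdist_le_1_iff[OF connected_graph_wheel, of 0 n w] w spoke_in_edges[of w n]
    by (auto simp: verts_wheel)
  ultimately have "elem_dist (wheel n) (Inl i) w \<noteq> elem_dist (wheel n) (Inr {0, i}) w" by simp
  with w show ?thesis by blast
qed

lemma mixed_resolving_rim:
  assumes "n \<ge> 4"
  shows "mixed_resolving (wheel n) {1..n}"
proof -
  let ?E = "verts (wheel n) <+> edges (wheel n)" and ?R = "{1..n}"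
  have simple: "simple_graph (wheel n)" using simple_graph_wheel assms by simp
  have sub: "ends x \<subseteq> {0..n}" if "x \<in> ?E" for x
    using that simple by (auto simp: simple_graph_def verts_wheel)
  \<comment> \<open>By symmetry, if only one of \<open>x\<close> and \<open>y\<close> contains the hub, then it may be taken to be \<open>y\<close>.\<close>
  have sep: "\<exists>w \<in> ?R. elem_dist (wheel n) x w \<noteq> elem_dist (wheel n) y w"
    if x: "x \<in> ?E" and y: "y \<in> ?E" and ne: "x \<noteq> y" and hub: "0 \<in> ends y \<or> 0 \<notin> ends x" for x y
  proof (cases "ends x \<inter> ?R = ends y \<inter> ?R")
    case False
    then show ?thesis
      using elem_dist_neq_if_ends[OF simple connected_graph_wheel x y] by (simp add: verts_wheel)
  next
    case True
    have rim: "k \<in> ends x \<longleftrightarrow> k \<in> ends y" if "k \<noteq> 0" for k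
    proof (cases "k \<le> n")
      case True
      then have "k \<in> ?R" using \<open>k \<noteq> 0\<close> by simp
      then show ?thesis using \<open>ends x \<inter> ?R = ends y \<inter> ?R\<close> by blast
    next
      case False
      then show ?thesis using sub[OF x] sub[OF y] by auto
    qed
    \<comment> \<open>The endpoint sets agree away from the hub, so they must differ at the hub
      itself.\<close>
    have "ends x \<noteq> ends y" using ends_inject[OF simple x y] ne by blast
    then have "0 \<in> ends x \<longleftrightarrow> 0 \<notin> ends y" using rim by (metis subsetI subset_antisym)
    then have fresh: "0 \<notin> ends x" and "0 \<in> ends y" using hub by blast+
    then have ends_y: "ends y = insert 0 (ends x)" using rim by (metis insert_iff subsetI subset_antisym)
    have card2: "card e = 2" "finite e" if "e \<in> edges (wheel n)" for e
      using that simple by (auto simp: simple_graph_def intro: card_ge_0_finite)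
    \<comment> \<open>If \<open>x\<close> were an edge, adding the hub would give \<open>y\<close>
      three endpoints.\<close>
    obtain i where xi: "x = Inl i"
    proof (cases x)
      case (Inr e)
      then have "card (ends y) = 3" using ends_y fresh card2[of e] x by auto
      then show ?thesis using y card2(1) by (cases y) auto
    qed
    then have i: "1 \<le> i" "i \<le> n" using fresh x by (auto simp: verts_wheel)
    have "y = Inr {0, i}" using ends_y xi i by (cases y) auto
    then show ?thesis using rim_separates_vertex_from_spoke[OF assms i] xi by simp
  qed
  have "\<exists>w \<in> ?R. elem_dist (wheel n) x w \<noteq> elem_dist (wheel n) y w"
    if "x \<in> ?E" "y \<in> ?E" "x \<noteq> y" for x y
  proof (cases "0 \<in> ends y \<or> 0 \<notin> ends x")
    case True
    then show ?thesis using sep[OF that] by blast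
  next
    case False
    then show ?thesis using sep[of y x] that by metis
  qed
  then show ?thesis unfolding mixed_resolving_def by (auto simp: verts_wheel)
qed

theorem theorem2p2:
  shows "mixed_metric_dim (wheel 3) = 4 \<and> (\<forall>n\<ge>4. mixed_metric_dim (wheel n) = n)"
proof (intro conjI allI impI)
  have "verts (wheel 3) \<subseteq> S" if "mixed_resolving (wheel 3) S" for S
  proof -
    have "verts (wheel 3) = insert 0 {1..3}" by (auto simp: verts_wheel)
    then show ?thesis
      using rim_subset_mixed_resolving[OF that] hub_in_mixed_resolving_wheel_3[OF that] by simp
  qed
  then have "mixed_metric_dim (wheel 3) = card (verts (wheel 3))"
    by (intro mixed_metric_dim_eqI mixed_resolving_verts simple_graph_wheel connected_graph_wheel)
       (auto simp: verts_wheel)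
  then show "mixed_metric_dim (wheel 3) = 4" by (simp add: verts_wheel)
next
  fix n :: nat assume "n \<ge> 4"
  then have "mixed_metric_dim (wheel n) = card {1..n}"
    by (intro mixed_metric_dim_eqI mixed_resolving_rim rim_subset_mixed_resolving)
       (auto simp: verts_wheel)
  then show "mixed_metric_dim (wheel n) = n" by simp
qed

end
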